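(* Let $k$ be an algebraically closed field of at least continuum cardinality and let $f\colon k^n \dashrightarrow k$ be a partial function defined on a nonempty Zariski open subset $\operatorname{dom} f$ of $k^n$. Suppose that for each $(a_1,\dots,a_n)\in\operatorname{dom} f$ and each $i\in\{1,\dots,n\}$ the partial function $f_{a_1,\dots,a_{i-1}}^{a_{i+1},\dots,a_n}\colon k\dashrightarrow k$ is a rational function. Then $f$ is a rational function.
   Context: A partial function $f\colon A\dashrightarrow B$ is a function defined on a subset $\operatorname{dom} f$ of $A$ (its domain of definition). For a partial function $f\colon A_1\times\dots\times A_n\dashrightarrow B$, a point $(a_1,\dots,a_n)\in A_1\times\dots\times A_n$ and $i\in\{1,\dots,n\}$, the partial function $f_{a_1,\dots,a_{i-1}}^{a_{i+1},\dots,a_n}\colon A_i\dashrightarrow B$ has domain $\{a\in A_i \mid (a_1,\dots,a_{i-1},a,a_{i+1},\dots,a_n)\in\operatorname{dom} f\}$ and sends $a$ to $f(a_1,\dots,a_{i-1},a,a_{i+1},\dots,a_n)$. For a variety $X$ over an algebraically closed field $k$ (classical varieties, identified with their sets of $k$-points, as in Serre's FAC), a partial function $f\colon X\dashrightarrow k$ is called a rational function if $\operatorname{dom} f$ is a Zariski dense open subset of $X$ and $f$ restricted to $\operatorname{dom} f$ is a morphism of varieties to the affine line $k$, i.e. a regular function on $\operatorname{dom} f$. Here $\operatorname{dom} f$ is part of the data of $f$ and need not be the maximal domain of regularity. *)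

theory Defs
  imports
    "HOL-Analysis.Abstract_Topology"
    "HOL-Library.Equipollence"
    "HOL-Computational_Algebra.Polynomial"
begin

text \<open>
  Points of \<open>k\<^sup>n\<close> are functions on the index set \<open>{1..n}\<close>, extended by \<^const>\<open>undefined\<close>
  to other indices. Polynomials enter through the functions they induce, which determine them over an
  infinite field. A partial function \<open>A \<rightharpoonup> B\<close> is a function into \<open>B option\<close>, so that its
  domain of definition \<^const>\<open>dom\<close> is part of its data.
\<close>

definition affine_space :: "nat \<Rightarrow> (nat \<Rightarrow> 'k::field) set" where
  "affine_space n = {1..n} \<rightarrow>\<^sub>E UNIV"

definition poly_fun :: "nat \<Rightarrow> ((nat \<Rightarrow> 'k::field) \<Rightarrow> 'k) \<Rightarrow> bool" where
  "poly_fun n p \<longleftrightarrow> (\<exists>(M :: (nat \<Rightarrow> nat) set) c. finite M \<and>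
     (\<forall>x. p x = (\<Sum>m\<in>M. c m * (\<Prod>i\<in>{1..n}. x i ^ m i))))"

definition zero_locus :: "nat \<Rightarrow> ((nat \<Rightarrow> 'k::field) \<Rightarrow> 'k) set \<Rightarrow> (nat \<Rightarrow> 'k) set" where
  "zero_locus n P = {x \<in> affine_space n. \<forall>p\<in>P. p x = 0}"

definition zariski :: "nat \<Rightarrow> (nat \<Rightarrow> 'k::field) topology" where
  "zariski n = topology (\<lambda>U. \<exists>P. (\<forall>p\<in>P. poly_fun n p) \<and> U = affine_space n - zero_locus n P)"

lemma poly_fun_sum_monomials:
  fixes e :: "'b \<Rightarrow> nat \<Rightarrow> nat"
  assumes "finite T"
  shows "poly_fun n (\<lambda>x. \<Sum>t\<in>T. c t * (\<Prod>i\<in>{1..n}. x i ^ e t i))"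
proof -
  have "(\<Sum>t\<in>T. c t * (\<Prod>i\<in>{1..n}. x i ^ e t i)) =
      (\<Sum>m\<in>e ` T. (\<Sum>t\<in>{t\<in>T. e t = m}. c t) * (\<Prod>i\<in>{1..n}. x i ^ m i))" for x
    by (subst sum.image_gen[OF assms, of _ e])
       (auto simp: sum_distrib_right intro!: sum.cong)
  then show ?thesis
    unfolding poly_fun_def using assms
    by (intro exI[of _ "e ` T"] exI[of _ "\<lambda>m. \<Sum>t\<in>{t\<in>T. e t = m}. c t"]) auto
qed

lemma poly_fun_mult:
  assumes "poly_fun n p" "poly_fun n q"
  shows "poly_fun n (\<lambda>x. p x * q x)"
proof -
  obtain M c where M: "finite M" "\<And>x. p x = (\<Sum>m\<in>M. c m * (\<Prod>i\<in>{1..n}. x i ^ m i))"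
    using assms(1) unfolding poly_fun_def by blast
  obtain N d where N: "finite N" "\<And>x. q x = (\<Sum>m\<in>N. d m * (\<Prod>i\<in>{1..n}. x i ^ m i))"
    using assms(2) unfolding poly_fun_def by blast
  have "p x * q x = (\<Sum>t\<in>M \<times> N. (c (fst t) * d (snd t)) *
      (\<Prod>i\<in>{1..n}. x i ^ (fst t i + snd t i)))" for x
    unfolding M(2) N(2) sum_product sum.cartesian_product
    by (intro sum.cong) (auto simp: power_add prod.distrib mult_ac)
  then show ?thesis
    using poly_fun_sum_monomials[of "M \<times> N" n "\<lambda>t. c (fst t) * d (snd t)"
        "\<lambda>t i. fst t i + snd t i"] M(1) N(1) by simp
qed

lemma openin_zariski:
  fixes U :: "(nat \<Rightarrow> 'k::field) set"
  shows "openin (zariski n) U \<longleftrightarrow>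
     (\<exists>P. (\<forall>p\<in>P. poly_fun n p) \<and> U = affine_space n - zero_locus n P)"
proof -
  let ?L = "\<lambda>U :: (nat \<Rightarrow> 'k) set. \<exists>P. (\<forall>p\<in>P. poly_fun n p) \<and> U = affine_space n - zero_locus n P"
  have "?L (S \<inter> T)" if ST: "?L S" "?L T" for S T
  proof -
    obtain P where P: "\<forall>p\<in>P. poly_fun n p" "S = affine_space n - zero_locus n P"
      using ST(1) by blast
    obtain Q where Q: "\<forall>q\<in>Q. poly_fun n q" "T = affine_space n - zero_locus n Q"
      using ST(2) by blast
    let ?R = "(\<lambda>(p, q) x. p x * q x) ` (P \<times> Q)"
    have "\<forall>r\<in>?R. poly_fun n r"
      using P(1) Q(1) by (auto intro: poly_fun_mult)
    moreover have "S \<inter> T = affine_space n - zero_locus n ?R"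
      unfolding P(2) Q(2) zero_locus_def by fastforce
    ultimately show ?thesis by blast
  qed
  moreover have "?L (\<Union>\<K>)" if K: "\<forall>K\<in>\<K>. ?L K" for \<K>
  proof -
    obtain P where P: "\<forall>K\<in>\<K>. (\<forall>p\<in>P K. poly_fun n p) \<and> K = affine_space n - zero_locus n (P K)"
      using bchoice[OF K] by blast
    have "\<Union>\<K> = affine_space n - zero_locus n (\<Union>K\<in>\<K>. P K)"
    proof -
      have "x \<in> \<Union>\<K> \<longleftrightarrow> x \<in> affine_space n \<and> (\<exists>K\<in>\<K>. \<exists>p\<in>P K. p x \<noteq> 0)" for x
        using P unfolding zero_locus_def by blast
      then show ?thesis unfolding zero_locus_def by blast
    qed
    moreover have "\<forall>p\<in>(\<Union>K\<in>\<K>. P K). poly_fun n p" using P by blast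
    ultimately show ?thesis by (intro exI[of _ "\<Union>K\<in>\<K>. P K"] conjI)
  qed
  ultimately have "istopology ?L"
    unfolding istopology_def by (intro conjI allI impI) simp_all
  then show ?thesis
    unfolding zariski_def by simp
qed

lemma topspace_zariski: "topspace (zariski n) = affine_space n"
proof
  show "topspace (zariski n) \<subseteq> affine_space n"
    unfolding topspace_def openin_zariski by blast
  have "poly_fun n (\<lambda>x. 1)"
    using poly_fun_sum_monomials[of "{()}" n "\<lambda>_. 1" "\<lambda>_ _. 0"] by simp
  then have "openin (zariski n) (affine_space n)"
    unfolding openin_zariski by (intro exI[of _ "{\<lambda>x. 1}"]) (auto simp: zero_locus_def)
  then show "affine_space n \<subseteq> topspace (zariski n)"
    by (rule openin_subset)
qed

definition regular_on ::
    "nat \<Rightarrow> (nat \<Rightarrow> 'k::field) set \<Rightarrow> ((nat \<Rightarrow> 'k) \<Rightarrow> 'k) \<Rightarrow> bool" where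
  "regular_on n U g \<longleftrightarrow> openin (zariski n) U \<and>
     (\<forall>x\<in>U. \<exists>V p q. openin (zariski n) V \<and> x \<in> V \<and> V \<subseteq> U \<and> poly_fun n p \<and> poly_fun n q \<and>
        (\<forall>y\<in>V. q y \<noteq> 0 \<and> g y = p y / q y))"

definition rational_function :: "nat \<Rightarrow> ((nat \<Rightarrow> 'k::field) \<rightharpoonup> 'k) \<Rightarrow> bool" where
  "rational_function n f \<longleftrightarrow>
     openin (zariski n) (dom f) \<and>
     zariski n closure_of dom f = topspace (zariski n) \<and>
     regular_on n (dom f) (\<lambda>x. the (f x))"

text \<open>\<open>slice f a i\<close> lets the \<open>i\<close>-th coordinate vary and fixes the others to those of \<open>a\<close>.\<close>

definition slice :: "((nat \<Rightarrow> 'k) \<rightharpoonup> 'k) \<Rightarrow> (nat \<Rightarrow> 'k) \<Rightarrow> nat \<Rightarrow> ('k \<rightharpoonup> 'k)" where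
  "slice f a i = (\<lambda>t. f (a(i := t)))"

text \<open>A partial function on \<open>k\<close>, transported along the identification of \<open>k\<^sup>1\<close> with \<open>k\<close>.\<close>

definition on_line :: "('k::field \<rightharpoonup> 'k) \<Rightarrow> ((nat \<Rightarrow> 'k) \<rightharpoonup> 'k)" where
  "on_line g = (\<lambda>x. if x \<in> affine_space 1 then g (x 1) else None)"

end

theory Submission
  imports Defs "HOL-Analysis.Continuum_Not_Denumerable"
begin

text \<open>
  On a basic open set \<open>D(u) \<subseteq> dom f\<close> we show, by induction on the number of variables, that
  \<open>f u\<^sup>N\<close> is a polynomial for some \<open>N\<close>. Fixing the last coordinate \<open>t\<close>, the induction hypothesis
  gives an exponent and a degree bound depending on \<open>t\<close>; there are countably many such pairs and
  uncountably many \<open>t\<close>, so one pair serves an infinite set \<open>T\<close> of values. Polynomials of bounded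
  degree form a finite-dimensional space, so for \<open>t \<in> T\<close> the function \<open>h = f u\<^sup>N\<close> is interpolated by
  finitely many of its restrictions to lines in the last direction, which are rational in \<open>t\<close>. Hence
  \<open>s(t) h\<close> is a polynomial on \<open>D(u)\<close> for some nonzero \<open>s\<close>, first for \<open>t \<in> T\<close> and then, since \<open>h\<close> is
  rational along lines, for all \<open>t\<close>. A linear factor \<open>t - \<alpha>\<close> of \<open>s\<close> is removed by multiplying with
  \<open>u\<close> if it divides \<open>u\<close>; otherwise \<open>u\<close> does not vanish identically on \<open>t = \<alpha>\<close>, so \<open>t - \<alpha>\<close> divides
  the polynomial \<open>s h\<close> and can be cancelled.
\<close>

section \<open>Polynomial functions\<close>

lemma poly_fun_const: "poly_fun n (\<lambda>_. c)"
  using poly_fun_sum_monomials[of "{()}" n "\<lambda>_. c" "\<lambda>_ _. 0"] by simp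

lemma poly_fun_coord:
  assumes "i \<in> {1..n}"
  shows "poly_fun n (\<lambda>x. x i)"
proof -
  have "(\<Sum>t\<in>{()}. 1 * (\<Prod>j\<in>{1..n}. x j ^ (if j = i then 1 else 0))) = x i" for x :: "nat \<Rightarrow> 'a"
    using assms by (subst prod.remove[of _ i]) auto
  moreover have "poly_fun n (\<lambda>x :: nat \<Rightarrow> 'a. \<Sum>t\<in>{()}. 1 * (\<Prod>j\<in>{1..n}. x j ^ (if j = i then 1 else 0)))"
    by (rule poly_fun_sum_monomials) simp
  ultimately show ?thesis by (simp only:)
qed

lemma poly_fun_add:
  assumes "poly_fun n p" "poly_fun n q"
  shows "poly_fun n (\<lambda>x. p x + q x)"
proof -
  obtain M c where M: "finite M" "\<And>x. p x = (\<Sum>m\<in>M. c m * (\<Prod>i\<in>{1..n}. x i ^ m i))"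
    using assms(1) unfolding poly_fun_def by blast
  obtain N d where N: "finite N" "\<And>x. q x = (\<Sum>m\<in>N. d m * (\<Prod>i\<in>{1..n}. x i ^ m i))"
    using assms(2) unfolding poly_fun_def by blast
  show ?thesis
    using poly_fun_sum_monomials[of "M <+> N" n "case_sum c d" "case_sum id id"] M N
    by (simp add: sum.Plus)
qed

lemma poly_fun_sum:
  "(\<And>j. j \<in> A \<Longrightarrow> poly_fun n (p j)) \<Longrightarrow> poly_fun n (\<lambda>x. \<Sum>j\<in>A. p j x)"
  by (induction A rule: infinite_finite_induct) (auto intro: poly_fun_const poly_fun_add)

lemma poly_fun_prod:
  "(\<And>j. j \<in> A \<Longrightarrow> poly_fun n (p j)) \<Longrightarrow> poly_fun n (\<lambda>x. \<Prod>j\<in>A. p j x)"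
  by (induction A rule: infinite_finite_induct) (auto intro: poly_fun_const poly_fun_mult)

lemma poly_fun_power: "poly_fun n p \<Longrightarrow> poly_fun n (\<lambda>x. p x ^ e)"
  by (induction e) (auto intro: poly_fun_const poly_fun_mult)

lemma poly_fun_diff:
  assumes "poly_fun n p" "poly_fun n q"
  shows "poly_fun n (\<lambda>x. p x - q x)"
  using poly_fun_add[OF assms(1) poly_fun_mult[OF poly_fun_const[of n "-1"] assms(2)]] by simp

lemma poly_fun_subst:
  assumes "poly_fun n p" "\<And>i. i \<in> {1..n} \<Longrightarrow> poly_fun m (\<lambda>x. g x i)"
  shows "poly_fun m (\<lambda>x. p (g x))"
proof -
  obtain M c where M: "finite M" "\<And>x. p x = (\<Sum>m\<in>M. c m * (\<Prod>i\<in>{1..n}. x i ^ m i))"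
    using assms(1) unfolding poly_fun_def by blast
  show ?thesis
    unfolding M(2)
    by (intro poly_fun_sum poly_fun_mult poly_fun_const poly_fun_prod poly_fun_power assms(2))
qed

text \<open>The index condition covers two uses: fixing one of \<open>n\<close> variables while
  staying in the same space, and fixing the last of \<open>Suc n\<close> variables to pass to
  \<open>n\<close>.\<close>

lemma poly_fun_upd:
  assumes "poly_fun m p" "{1..m} - {i} \<subseteq> {1..n}"
  shows "poly_fun n (\<lambda>x. p (x(i := t)))"
proof (rule poly_fun_subst[OF assms(1)])
  show "poly_fun n (\<lambda>x. (x(i := t)) j)" if "j \<in> {1..m}" for j
    using that assms(2) poly_fun_coord[of j n] by (cases "j = i") (auto intro: poly_fun_const)
qed

lemma poly_fun_poly:
  assumes "poly_fun n p"
  shows "poly_fun n (\<lambda>x. poly P (p x))"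
  unfolding poly_altdef
  by (intro poly_fun_sum poly_fun_mult poly_fun_const poly_fun_power assms)

lemma poly_fun_cong:
  assumes "poly_fun n p" "\<And>i. i \<in> {1..n} \<Longrightarrow> x i = y i"
  shows "p x = p y"
proof -
  obtain M c where M: "finite M" "\<And>x. p x = (\<Sum>m\<in>M. c m * (\<Prod>i\<in>{1..n}. x i ^ m i))"
    using assms(1) unfolding poly_fun_def by blast
  show ?thesis unfolding M(2) using assms(2) by (intro sum.cong prod.cong arg_cong2[where f = "(*)"]) auto
qed

lemma poly_fun_curve:
  assumes "poly_fun n p" "\<And>i. i \<in> {1..n} \<Longrightarrow> \<exists>P. \<forall>t. g t i = poly P t"
  shows "\<exists>P. \<forall>t. p (g t) = poly P t"
proof -
  obtain M c where M: "finite M" "\<And>x. p x = (\<Sum>m\<in>M. c m * (\<Prod>i\<in>{1..n}. x i ^ m i))"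
    using assms(1) unfolding poly_fun_def by blast
  obtain P where P: "\<And>i t. i \<in> {1..n} \<Longrightarrow> g t i = poly (P i) t"
    using assms(2) by metis
  have "p (g t) = poly (\<Sum>m\<in>M. [:c m:] * (\<Prod>i\<in>{1..n}. P i ^ m i)) t" for t
    unfolding M(2) poly_sum poly_mult poly_prod poly_power using P by simp
  then show ?thesis by blast
qed

lemma poly_fun_upd_poly:
  assumes "poly_fun n p"
  shows "\<exists>P. \<forall>t. p (x(i := t)) = poly P t"
proof (rule poly_fun_curve[OF assms])
  show "\<exists>P. \<forall>t. (x(i := t)) j = poly P t" for j
    by (cases "j = i") (auto intro: exI[of _ "[:0, 1:]"] exI[of _ "[:x j:]"])
qed

lemma finite_upd_zeros:
  fixes p :: "(nat \<Rightarrow> 'k::field) \<Rightarrow> 'k"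
  assumes "poly_fun n p" "p (x(i := t0)) \<noteq> 0"
  shows "finite {t. p (x(i := t)) = 0}"
proof -
  obtain P where P: "\<And>t. p (x(i := t)) = poly P t"
    using poly_fun_upd_poly[OF assms(1)] by blast
  then have "P \<noteq> 0" using assms(2) by auto
  then show ?thesis unfolding P by (rule poly_roots_finite)
qed

lemma poly_eq_on_infinite:
  fixes P Q :: "'k::field poly"
  assumes "infinite A" "\<And>t. t \<in> A \<Longrightarrow> poly P t = poly Q t"
  shows "P = Q"
proof (rule ccontr)
  assume "P \<noteq> Q"
  then have "finite {t. poly (P - Q) t = 0}" by (intro poly_roots_finite) simp
  then show False using assms finite_subset[of A "{t. poly (P - Q) t = 0}"] by auto
qed

text \<open>The two nonvanishing loci meet on the line joining a point of each.\<close>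

lemma poly_fun_nonzero_common:
  fixes p q :: "(nat \<Rightarrow> 'k::field) \<Rightarrow> 'k"
  assumes "infinite (UNIV :: 'k set)"
    and "poly_fun n p" "poly_fun n q" "p a \<noteq> 0" "q b \<noteq> 0"
  shows "\<exists>x. p x \<noteq> 0 \<and> q x \<noteq> 0"
proof -
  define g where "g t i = a i + t * (b i - a i)" for t i
  have g: "\<exists>P. \<forall>t. g t i = poly P t" for i
    by (rule exI[of _ "[:a i, b i - a i:]"]) (simp add: g_def)
  obtain P where P: "\<And>t. p (g t) = poly P t" using poly_fun_curve[OF assms(2), of g] g by blast
  obtain Q where Q: "\<And>t. q (g t) = poly Q t" using poly_fun_curve[OF assms(3), of g] g by blast
  have g01: "g 0 = a" "g 1 = b" by (auto simp: g_def)
  have "P * Q \<noteq> 0" using P[of 0] Q[of 1] assms(4,5) g01 by auto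
  then have "\<exists>t. poly (P * Q) t \<noteq> 0"
    using poly_eq_on_infinite[OF assms(1), of "P * Q" 0] by auto
  then show ?thesis using P Q by (metis mult_eq_0_iff poly_mult)
qed

text \<open>Subtracting the zero value at \<open>x i = \<alpha>\<close> turns each power
  \<open>x i ^ m i\<close> into \<open>x i ^ m i - \<alpha> ^ m i\<close>, which is divisible by
  \<open>x i - \<alpha>\<close>.\<close>

lemma poly_fun_factor:
  assumes "poly_fun n p" "i \<in> {1..n}" "\<And>x. p (x(i := \<alpha>)) = 0"
  obtains q where "poly_fun n q" "\<And>x. p x = (x i - \<alpha>) * q x"
proof -
  obtain M c where M: "finite M" "\<And>x. p x = (\<Sum>m\<in>M. c m * (\<Prod>i\<in>{1..n}. x i ^ m i))"
    using assms(1) unfolding poly_fun_def by blast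
  define r where "r m x = c m * (\<Prod>j\<in>{1..n}-{i}. x j ^ m j)" for m x
  define q where "q x = (\<Sum>m\<in>M. r m x * (\<Sum>j<m i. \<alpha> ^ (m i - Suc j) * x i ^ j))" for x
  have split: "p x = (\<Sum>m\<in>M. r m x * x i ^ m i)" for x
    unfolding M(2) r_def using assms(2) by (subst prod.remove[of _ i]) (auto simp: mult_ac)
  have "p x = (x i - \<alpha>) * q x" for x
  proof -
    have "p x = p x - p (x(i := \<alpha>))" using assms(3) by simp
    also have "p (x(i := \<alpha>)) = (\<Sum>m\<in>M. r m x * \<alpha> ^ m i)"
      unfolding split by (simp add: r_def)
    also have "p x - \<dots> = (\<Sum>m\<in>M. r m x * (x i ^ m i - \<alpha> ^ m i))"
      unfolding split by (simp add: sum_subtractf right_diff_distrib)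
    also have "\<dots> = (x i - \<alpha>) * q x"
      unfolding q_def sum_distrib_left power_diff_sumr2[of "x i" _ \<alpha>] by (simp add: mult_ac)
    finally show ?thesis .
  qed
  moreover have "poly_fun n q"
    unfolding q_def r_def using assms(2)
    by (intro poly_fun_sum poly_fun_mult poly_fun_const poly_fun_prod poly_fun_power poly_fun_coord) auto
  ultimately show ?thesis by (rule that[rotated])
qed

section \<open>Monomials and degree bounds\<close>

definition monom_fun :: "nat \<Rightarrow> (nat \<Rightarrow> nat) \<Rightarrow> (nat \<Rightarrow> 'k::field) \<Rightarrow> 'k" where
  "monom_fun n m x = (\<Prod>i\<in>{1..n}. x i ^ m i)"

lemma poly_fun_monom_fun: "poly_fun n (monom_fun n m)"
  unfolding monom_fun_def by (intro poly_fun_prod poly_fun_power poly_fun_coord)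

text \<open>A single number \<open>d\<close> confines the exponents to a finite box, so that only
  countably many boxes occur in the later counting argument. Exponents outside \<open>{1..n}\<close>
  do not affect values; members of \<open>M\<close> with equal restrictions are merged by adding
  their coefficients.\<close>

lemma poly_fun_bounded:
  assumes "poly_fun n p"
  shows "\<exists>d c. \<forall>x. p x = (\<Sum>m\<in>{1..n} \<rightarrow>\<^sub>E {..d::nat}. c m * monom_fun n m x)"
proof -
  obtain M c where M: "finite M" "\<And>x. p x = (\<Sum>m\<in>M. c m * (\<Prod>i\<in>{1..n}. x i ^ m i))"
    using assms unfolding poly_fun_def by blast
  \<comment> \<open>\<open>insert 0\<close> keeps the maximum meaningful when \<open>M\<close> or
    \<open>{1..n}\<close> is empty.\<close>
  define d where "d = Max (insert 0 ((\<lambda>(m, i). m i) ` (M \<times> {1..n})))"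
  have d: "m i \<le> d" if "m \<in> M" "i \<in> {1..n}" for m i
    unfolding d_def using that M(1) by (intro Max_ge) auto
  have fin: "finite ({1..n} \<rightarrow>\<^sub>E {..d})" by (intro finite_PiE) auto
  have sub: "(\<lambda>m. restrict m {1..n}) ` M \<subseteq> {1..n} \<rightarrow>\<^sub>E {..d}"
    using d by fastforce
  have "p x = (\<Sum>l\<in>{1..n} \<rightarrow>\<^sub>E {..d}.
      (\<Sum>m\<in>{m\<in>M. restrict m {1..n} = l}. c m) * monom_fun n l x)" for x
  proof -
    have "p x = (\<Sum>l\<in>{1..n} \<rightarrow>\<^sub>E {..d}.
        \<Sum>m\<in>{m\<in>M. restrict m {1..n} = l}. c m * (\<Prod>i\<in>{1..n}. x i ^ m i))"
      unfolding M(2) by (rule sum.group[symmetric, OF M(1) fin sub])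
    also have "\<dots> = (\<Sum>l\<in>{1..n} \<rightarrow>\<^sub>E {..d}.
        (\<Sum>m\<in>{m\<in>M. restrict m {1..n} = l}. c m) * monom_fun n l x)"
      unfolding sum_distrib_right monom_fun_def by (intro sum.cong) auto
    finally show ?thesis .
  qed
  then show ?thesis
    by (intro exI[of _ d] exI[of _ "\<lambda>l. \<Sum>m\<in>{m\<in>M. restrict m {1..n} = l}. c m"]) blast
qed

section \<open>Interpolation\<close>

text \<open>The nodes \<open>y j\<close> need not be distinct; indexing them avoids maintaining \<open>L i (y j) = 0\<close> for
  \<open>i \<noteq> j\<close> in the induction.\<close>

lemma interpolation:
  fixes B :: "((nat \<Rightarrow> 'k::field) \<Rightarrow> 'k) set"
  assumes "finite B" "\<And>b. b \<in> B \<Longrightarrow> poly_fun n b"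
  shows "\<exists>(r::nat) y L. (\<forall>j<r. y j \<in> S \<and> poly_fun n (L j)) \<and>
    (\<forall>b\<in>B. \<forall>x\<in>S. b x = (\<Sum>j<r. b (y j) * L j x))"
  using assms
proof (induction B rule: finite_induct)
  case empty
  then show ?case by (auto intro!: exI[of _ "0::nat"])
next
  case (insert b B)
  then obtain r :: nat and y L where IH: "\<And>j. j < r \<Longrightarrow> y j \<in> S" "\<And>j. j < r \<Longrightarrow> poly_fun n (L j)"
    "\<And>b x. b \<in> B \<Longrightarrow> x \<in> S \<Longrightarrow> b x = (\<Sum>j<r. b (y j) * L j x)"
    by (metis insertI2)
  \<comment> \<open>The error of the present formula at \<open>b\<close>. If it vanishes on
    \<open>S\<close>, the old nodes suffice; otherwise a point where it is nonzero becomes the new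
    node.\<close>
  define e where "e x = b x - (\<Sum>j<r. b (y j) * L j x)" for x
  show ?case
  proof (cases "\<forall>x\<in>S. e x = 0")
    case True
    then show ?thesis using IH unfolding e_def
      by (intro exI[of _ r] exI[of _ y] exI[of _ L]) auto
  next
    case False
    then obtain z where z: "z \<in> S" "e z \<noteq> 0" by blast
    define y' where "y' = y(r := z)"
    define L' where "L' j x = (if j = r then e x / e z else L j x - L j z * (e x / e z))" for j x
    have e: "poly_fun n e"
      unfolding e_def using insert.prems IH(2)
      by (intro poly_fun_diff poly_fun_sum poly_fun_mult poly_fun_const) auto
    have ediv: "poly_fun n (\<lambda>x. e x / e z)"
      using poly_fun_mult[OF e poly_fun_const[of n "inverse (e z)"]] by (simp add: field_simps)
    have L': "poly_fun n (L' j)" if "j < Suc r" for j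
    proof (cases "j = r")
      case True
      then show ?thesis using ediv unfolding L'_def by simp
    next
      case False
      then have "L' j = (\<lambda>x. L j x - L j z * (e x / e z))" by (auto simp: L'_def)
      then show ?thesis
        using poly_fun_diff[OF IH(2) poly_fun_mult[OF poly_fun_const ediv]] that False by simp
    qed
    \<comment> \<open>The correction is the old error of \<open>g\<close> at \<open>z\<close>, times
      \<open>e x / e z\<close>. It is zero for \<open>g \<in> B\<close>, and for
      \<open>g = b\<close> it equals \<open>e x\<close>, exactly what was missing.\<close>
    have sum': "(\<Sum>j<Suc r. g (y' j) * L' j x) =
      (\<Sum>j<r. g (y j) * L j x) + (g z - (\<Sum>j<r. g (y j) * L j z)) * (e x / e z)" for g x
    proof -
      have "(\<Sum>j<Suc r. g (y' j) * L' j x) =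
          (\<Sum>j<r. g (y j) * (L j x - L j z * (e x / e z))) + g z * (e x / e z)"
        by (simp add: y'_def L'_def)
      also have "(\<Sum>j<r. g (y j) * (L j x - L j z * (e x / e z))) =
          (\<Sum>j<r. g (y j) * L j x) - (\<Sum>j<r. g (y j) * L j z) * (e x / e z)"
        unfolding sum_distrib_right sum_subtractf[symmetric]
        by (intro sum.cong) (auto simp: right_diff_distrib mult.assoc)
      finally show ?thesis by (simp add: algebra_simps)
    qed
    have "g x = (\<Sum>j<Suc r. g (y' j) * L' j x)" if "g \<in> insert b B" "x \<in> S" for g x
    proof (cases "g = b")
      case True
      have "b z - (\<Sum>j<r. b (y j) * L j z) = e z" by (simp add: e_def)
      then show ?thesis unfolding sum' True using z by (simp add: e_def)
    next
      case False
      then have "g \<in> B" using that by auto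
      then show ?thesis unfolding sum' using IH(3)[of g x] IH(3)[of g z] that z by simp
    qed
    moreover have "y' j \<in> S" if "j < Suc r" for j
      using that IH(1) z by (auto simp: y'_def less_Suc_eq)
    ultimately show ?thesis using L'
      by (intro exI[of _ "Suc r"] exI[of _ y'] exI[of _ L']) blast
  qed
qed

section \<open>Separately rational functions\<close>

text \<open>One quotient must serve the whole part of the line lying in D(\<open>u\<close>). For a
  line that misses D(\<open>u\<close>) the condition is vacuous and \<open>Q\<close> may be
  zero.\<close>

definition line_rational :: "((nat \<Rightarrow> 'k::field) \<Rightarrow> 'k) \<Rightarrow> ((nat \<Rightarrow> 'k) \<Rightarrow> 'k) \<Rightarrow> nat \<Rightarrow> (nat \<Rightarrow> 'k) \<Rightarrow> bool"
  where "line_rational u F i x \<longleftrightarrow> (\<exists>P Q. \<forall>t. u (x(i := t)) \<noteq> 0 \<longrightarrow>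
    poly Q t \<noteq> 0 \<and> F (x(i := t)) = poly P t / poly Q t)"

lemma line_rational_mult_poly_fun:
  assumes "line_rational u F i x" "poly_fun n v"
  shows "line_rational u (\<lambda>x. F x * v x) i x"
proof -
  obtain P Q where PQ: "\<And>t. u (x(i := t)) \<noteq> 0 \<Longrightarrow>
      poly Q t \<noteq> 0 \<and> F (x(i := t)) = poly P t / poly Q t"
    using assms(1) unfolding line_rational_def by blast
  obtain V where V: "\<And>t. v (x(i := t)) = poly V t"
    using poly_fun_upd_poly[OF assms(2)] by blast
  show ?thesis unfolding line_rational_def
    using PQ V by (intro exI[of _ "P * V"] exI[of _ Q]) auto
qed

text \<open>Multiplied by the denominator \<open>Q\<close>, the equation becomes
  \<open>s * P = H * Q\<close> between polynomials in \<open>t\<close>, so infinitely many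
  parameters decide it.\<close>

lemma line_rational_identity:
  fixes u F G :: "(nat \<Rightarrow> 'k::field) \<Rightarrow> 'k"
  assumes "line_rational u F i x" "poly_fun n G" "infinite A"
    and A: "\<And>t. t \<in> A \<Longrightarrow> u (x(i := t)) \<noteq> 0 \<and> poly s t * F (x(i := t)) = G (x(i := t))"
    and t: "u (x(i := t)) \<noteq> 0"
  shows "poly s t * F (x(i := t)) = G (x(i := t))"
proof -
  obtain P Q where PQ: "\<And>t. u (x(i := t)) \<noteq> 0 \<Longrightarrow>
      poly Q t \<noteq> 0 \<and> F (x(i := t)) = poly P t / poly Q t"
    using assms(1) unfolding line_rational_def by blast
  obtain H where H: "\<And>t. G (x(i := t)) = poly H t"
    using poly_fun_upd_poly[OF assms(2)] by blast
  have "s * P = H * Q"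
    by (rule poly_eq_on_infinite[OF assms(3)]) (use PQ H A in \<open>fastforce simp: field_simps\<close>)
  then have "poly s t * poly P t = poly H t * poly Q t"
    by (metis poly_mult)
  then show ?thesis using PQ[OF t] H by (simp add: field_simps)
qed

text \<open>Each induction step splits off one root of \<open>s\<close>. The function
  \<open>h\<close> varies as well, because absorbing a linear factor into \<open>u\<close> replaces
  \<open>h\<close> by \<open>h * u\<close>.\<close>

lemma clear_denominator:
  fixes u h G :: "(nat \<Rightarrow> 'k::alg_closed_field) \<Rightarrow> 'k"
  assumes inf: "infinite (UNIV :: 'k set)"
    and i: "i \<in> {1..n}"
    and "poly_fun n u" "poly_fun n G" "s \<noteq> 0"
    and "\<And>x. u x \<noteq> 0 \<Longrightarrow> line_rational u h i x"
    and "\<And>x. u x \<noteq> 0 \<Longrightarrow> poly s (x i) * h x = G x"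
  shows "\<exists>N H. poly_fun n H \<and> (\<forall>x. u x \<noteq> 0 \<longrightarrow> h x * u x ^ N = H x)"
  using assms(3-)
proof (induction "degree s" arbitrary: s h G)
  case 0
  then obtain c where c: "s = [:c:]" "c \<noteq> 0" by (metis degree_eq_zeroE pCons_eq_0_iff)
  have "h x = inverse c * G x" if "u x \<noteq> 0" for x
    using c "0.prems"(5)[OF that] by (simp add: field_simps)
  then show ?case
    using poly_fun_mult[OF poly_fun_const "0.prems"(2)]
    by (intro exI[of _ 0] exI[of _ "\<lambda>x. inverse c * G x"]) auto
next
  case (Suc d)
  then obtain \<alpha> where \<alpha>: "poly s \<alpha> = 0" using alg_closed_imp_poly_has_root[of s] by auto
  then obtain s' where s': "s = [:-\<alpha>, 1:] * s'" using poly_eq_0_iff_dvd by (auto simp: dvd_def)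
  have s'0: "s' \<noteq> 0" using s' Suc.prems(3) by auto
  have deg: "d = degree s'"
    using Suc.hyps(2) s'0 unfolding s' by (subst (asm) degree_mult_eq) auto
  have eq: "(x i - \<alpha>) * (poly s' (x i) * h x) = G x" if "u x \<noteq> 0" for x
    using Suc.prems(5)[OF that] s' by (simp add: algebra_simps)
  show ?case
  proof (cases "\<forall>x. u (x(i := \<alpha>)) = 0")
    case True
    then obtain v where v: "poly_fun n v" "\<And>x. u x = (x i - \<alpha>) * v x"
      using poly_fun_factor[OF Suc.prems(1) i] by metis
    have "poly s' (x i) * (h x * u x) = G x * v x" if "u x \<noteq> 0" for x
    proof -
      have "poly s' (x i) * (h x * u x) = ((x i - \<alpha>) * (poly s' (x i) * h x)) * v x"
        unfolding v(2)[of x] by (simp only: mult_ac)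
      then show ?thesis unfolding eq[OF that] .
    qed
    then have "\<exists>N H. poly_fun n H \<and> (\<forall>x. u x \<noteq> 0 \<longrightarrow> (h x * u x) * u x ^ N = H x)"
      using Suc.prems(1,2,4) v(1) s'0
      by (intro Suc.hyps(1)[OF deg, of "\<lambda>x. G x * v x"])
         (auto intro: poly_fun_mult line_rational_mult_poly_fun)
    then obtain N H where "poly_fun n H" "\<And>x. u x \<noteq> 0 \<Longrightarrow> (h x * u x) * u x ^ N = H x"
      by blast
    then show ?thesis by (intro exI[of _ "Suc N"] exI[of _ H]) (auto simp: mult_ac)
  next
    case False
    then obtain a where a: "u (a(i := \<alpha>)) \<noteq> 0" by blast
    have upd: "poly_fun n (\<lambda>x. p (x(i := \<alpha>)))" if "poly_fun n p" for p :: "(nat \<Rightarrow> 'k) \<Rightarrow> 'k"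
      by (rule poly_fun_upd[OF that]) auto
    \<comment> \<open>Otherwise \<open>u\<close> and \<open>G\<close> would both be nonzero at some
      point of the hyperplane \<open>x i = \<alpha>\<close>, where \<open>eq\<close> forces
      \<open>G\<close> to vanish.\<close>
    have G0: "G (x(i := \<alpha>)) = 0" for x
    proof (rule ccontr)
      assume "G (x(i := \<alpha>)) \<noteq> 0"
      then obtain y where "u (y(i := \<alpha>)) \<noteq> 0" "G (y(i := \<alpha>)) \<noteq> 0"
        using poly_fun_nonzero_common[OF inf upd[OF Suc.prems(1)] upd[OF Suc.prems(2)] a] by blast
      then show False using eq[of "y(i := \<alpha>)"] by simp
    qed
    obtain G' where G': "poly_fun n G'" "\<And>x. G x = (x i - \<alpha>) * G' x"
      using poly_fun_factor[OF Suc.prems(2) i G0] by metis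
    \<comment> \<open>Cancelling \<open>x i - \<alpha>\<close> is possible only off the hyperplane;
      points on it are reached by the identity principle along the line in direction
      \<open>i\<close>.\<close>
    have "poly s' (x i) * h x = G' x" if ux: "u x \<noteq> 0" for x
    proof -
      let ?A = "UNIV - ({t. u (x(i := t)) = 0} \<union> {\<alpha>})"
      have "infinite ?A"
        using inf finite_upd_zeros[OF Suc.prems(1), of x i "x i"] ux by (intro Diff_infinite_finite) auto
      then have "poly s' (x i) * h (x(i := x i)) = G' (x(i := x i))"
      proof (rule line_rational_identity[OF Suc.prems(4)[OF ux] G'(1)])
        fix t assume t: "t \<in> ?A"
        then have "(t - \<alpha>) * (poly s' t * h (x(i := t))) = (t - \<alpha>) * G' (x(i := t))"
          using eq[of "x(i := t)"] G'(2)[of "x(i := t)"] by simp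
        then show "u (x(i := t)) \<noteq> 0 \<and> poly s' t * h (x(i := t)) = G' (x(i := t))"
          using t by simp
      qed (use ux in simp)
      then show ?thesis by simp
    qed
    then show ?thesis
      using Suc.prems(1,4) G'(1) s'0 by (intro Suc.hyps(1)[OF deg, of G']) auto
  qed
qed

section \<open>Induction on the number of variables\<close>

lemma infinite_fibre:
  fixes g :: "'k \<Rightarrow> 'c::countable"
  assumes "uncountable (UNIV :: 'k set)"
  shows "\<exists>c. infinite {t. g t = c}"
proof (rule ccontr)
  assume "\<not> ?thesis"
  then have "countable (\<Union>c. {t. g t = c})" by (intro countable_UN) (auto intro: countable_finite)
  moreover have "(\<Union>c. {t. g t = c}) = UNIV" by auto
  ultimately show False using assms by simp
qed

text \<open>Points are arbitrary functions on \<open>nat\<close>. The congruence condition makes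
  \<open>F\<close> a function of the first \<open>n\<close> coordinates, so that the induction can
  freeze the last one by an update.\<close>

lemma separately_rational_localization:
  fixes u F :: "(nat \<Rightarrow> 'k::alg_closed_field) \<Rightarrow> 'k"
  assumes unc: "uncountable (UNIV :: 'k set)"
    and "poly_fun n u"
    and "\<And>x y. (\<And>i. i \<in> {1..n} \<Longrightarrow> x i = y i) \<Longrightarrow> F x = F y"
    and "\<And>x i. i \<in> {1..n} \<Longrightarrow> u x \<noteq> 0 \<Longrightarrow> line_rational u F i x"
  shows "\<exists>N G. poly_fun n G \<and> (\<forall>x. u x \<noteq> 0 \<longrightarrow> F x * u x ^ N = G x)"
  using assms(2-)
proof (induction n arbitrary: u F)
  case 0
  have "F = (\<lambda>_. F undefined)" using "0.prems"(2) by fastforce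
  then have "poly_fun 0 F" using poly_fun_const by metis
  then show ?case by (intro exI[of _ 0] exI[of _ F]) auto
next
  case (Suc n)
  let ?i = "Suc n"
  have inf: "infinite (UNIV :: 'k set)" using unc countable_finite by blast
  have slice: "\<exists>N G. poly_fun n G \<and> (\<forall>x. u (x(?i := t)) \<noteq> 0 \<longrightarrow> F (x(?i := t)) * u (x(?i := t)) ^ N = G x)" for t
  proof (rule Suc.IH)
    show "poly_fun n (\<lambda>x. u (x(?i := t)))"
      by (rule poly_fun_upd[OF Suc.prems(1)]) auto
    show "F (x(?i := t)) = F (y(?i := t))" if "\<And>j. j \<in> {1..n} \<Longrightarrow> x j = y j" for x y
      using that by (intro Suc.prems(2)) auto
    show "line_rational (\<lambda>x. u (x(?i := t))) (\<lambda>x. F (x(?i := t))) j x"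
      if "j \<in> {1..n}" "u (x(?i := t)) \<noteq> 0" for x j
    proof -
      have "(x(j := r))(?i := t) = (x(?i := t))(j := r)" for r
        using that by (auto simp: fun_upd_def)
      moreover have "line_rational u F j (x(?i := t))"
        by (rule Suc.prems(3)) (use that in \<open>simp_all del: fun_upd_apply\<close>)
      ultimately show ?thesis unfolding line_rational_def by simp
    qed
  qed
  let ?M = "\<lambda>d. {1..n} \<rightarrow>\<^sub>E {..d::nat}"
  define rep where "rep t N d c \<longleftrightarrow> (\<forall>x. u (x(?i := t)) \<noteq> 0 \<longrightarrow>
      F (x(?i := t)) * u (x(?i := t)) ^ N = (\<Sum>m\<in>?M d. c m * monom_fun n m x))" for t N d c
  have "\<exists>N d c. rep t N d c" for t
  proof -
    obtain N G where G: "poly_fun n G"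
      "\<And>x. u (x(?i := t)) \<noteq> 0 \<Longrightarrow> F (x(?i := t)) * u (x(?i := t)) ^ N = G x"
      using slice[of t] by blast
    obtain d c where "\<And>x. G x = (\<Sum>m\<in>?M d. c m * monom_fun n m x)"
      using poly_fun_bounded[OF G(1)] by blast
    then show ?thesis using G(2) unfolding rep_def
      by (intro exI[of _ N] exI[of _ d] exI[of _ c]) simp
  qed
  then obtain N d c where rep: "\<And>t. rep t (N t) (d t) (c t)"
    by metis
  obtain N0 d0 where "infinite {t. (N t, d t) = (N0, d0)}"
    using infinite_fibre[OF unc, of "\<lambda>t. (N t, d t)"] by (metis surj_pair)
  moreover define T where "T = {t. N t = N0 \<and> d t = d0}"
  ultimately have T: "infinite T" by simp
  define h where "h x = F x * u x ^ N0" for x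
  \<comment> \<open>Points whose line in the last direction meets D(\<open>u\<close>). Nodes are
    taken from here so that \<open>h\<close> along their lines has a nonzero denominator.\<close>
  define S where "S = {x. \<exists>t. u (x(?i := t)) \<noteq> 0}"
  have h: "h (x(?i := t)) = (\<Sum>m\<in>?M d0. c t m * monom_fun n m x)"
    if "t \<in> T" "u (x(?i := t)) \<noteq> 0" for t x
    using rep[of t] that unfolding rep_def h_def T_def by auto
  have h_line: "line_rational u h ?i x" if x: "x \<in> S" for x
  proof -
    obtain t where "u (x(?i := t)) \<noteq> 0" using x S_def by blast
    then have "line_rational u h ?i (x(?i := t))"
      unfolding h_def using Suc.prems(1,3)
      by (intro line_rational_mult_poly_fun poly_fun_power) auto
    then show ?thesis unfolding line_rational_def by simp
  qed
  have "finite (monom_fun n ` ?M d0 :: ((nat \<Rightarrow> 'k) \<Rightarrow> 'k) set)"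
    by (intro finite_imageI finite_PiE) auto
  moreover have "poly_fun n b" if "b \<in> monom_fun n ` ?M d0" for b :: "(nat \<Rightarrow> 'k) \<Rightarrow> 'k"
    using that poly_fun_monom_fun by auto
  ultimately obtain r :: nat and y L where rL: "\<forall>j<r. y j \<in> S \<and> poly_fun n (L j)"
      "\<forall>b\<in>monom_fun n ` ?M d0. \<forall>x\<in>S. b x = (\<Sum>j<r. b (y j) * L j x)"
    using interpolation[of "monom_fun n ` ?M d0" n S] by (elim meta_impE exE conjE)
  have node: "y j \<in> S" "poly_fun n (L j)" if "j < r" for j
    using rL(1) that by auto
  have L: "b x = (\<Sum>j<r. b (y j) * L j x)" if "b \<in> monom_fun n ` ?M d0" "x \<in> S" for b x
    using rL(2) that by blast
  \<comment> \<open>The finitely many parameters at which some node leaves D(\<open>u\<close>),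
    where \<open>h\<close> carries no information.\<close>
  define Z where "Z = (\<Union>j<r. {t. u ((y j)(?i := t)) = 0})"
  have "finite Z"
    unfolding Z_def using node(1) finite_upd_zeros[OF Suc.prems(1)] unfolding S_def by blast
  have T': "infinite (T - Z)"
    using T \<open>finite Z\<close> by (rule Diff_infinite_finite[rotated])
  have h_interp: "h (x(?i := t)) = (\<Sum>j<r. h ((y j)(?i := t)) * L j x)"
    if "t \<in> T - Z" "u (x(?i := t)) \<noteq> 0" for t x
  proof -
    have "x \<in> S" using that S_def by blast
    have "h (x(?i := t)) = (\<Sum>m\<in>?M d0. c t m * monom_fun n m x)"
      using h that by blast
    also have "\<dots> = (\<Sum>m\<in>?M d0. \<Sum>j<r. c t m * monom_fun n m (y j) * L j x)"
    proof (intro sum.cong refl)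
      fix m assume "m \<in> ?M d0"
      then have "monom_fun n m x = (\<Sum>j<r. monom_fun n m (y j) * L j x)"
        using L[OF imageI \<open>x \<in> S\<close>] by blast
      then show "c t m * monom_fun n m x = (\<Sum>j<r. c t m * monom_fun n m (y j) * L j x)"
        by (simp add: sum_distrib_left mult.assoc)
    qed
    also have "\<dots> = (\<Sum>j<r. (\<Sum>m\<in>?M d0. c t m * monom_fun n m (y j)) * L j x)"
      by (subst sum.swap) (simp add: sum_distrib_right)
    \<comment> \<open>The coefficients \<open>c t m\<close> that describe \<open>h\<close> at
      \<open>x\<close> describe it at the nodes too, since they depend only on
      \<open>t\<close>.\<close>
    also have "\<dots> = (\<Sum>j<r. h ((y j)(?i := t)) * L j x)"
      using that(1) by (intro sum.cong refl) (subst h, auto simp: Z_def)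
    finally show ?thesis .
  qed
  have "\<exists>P Q. Q \<noteq> 0 \<and> (\<forall>t. u ((y j)(?i := t)) \<noteq> 0 \<longrightarrow>
      poly Q t \<noteq> 0 \<and> h ((y j)(?i := t)) = poly P t / poly Q t)" if j: "j < r" for j
  proof -
    obtain t where t: "u ((y j)(?i := t)) \<noteq> 0" using node(1)[OF j] S_def by blast
    show ?thesis using h_line[OF node(1)[OF j]] t unfolding line_rational_def by (metis poly_0)
  qed
  then obtain P Q where PQ: "\<And>j. j < r \<Longrightarrow> Q j \<noteq> 0"
    "\<And>j t. j < r \<Longrightarrow> u ((y j)(?i := t)) \<noteq> 0 \<Longrightarrow>
      poly (Q j) t \<noteq> 0 \<and> h ((y j)(?i := t)) = poly (P j) t / poly (Q j) t"
    by metis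
  \<comment> \<open>A common denominator, in the last coordinate, of the restrictions of
    \<open>h\<close> to the node lines.\<close>
  define s where "s = (\<Prod>j<r. Q j)"
  have s0: "s \<noteq> 0" unfolding s_def using PQ(1) by auto
  define R where "R j = P j * (s div Q j)" for j
  have R: "poly s t * h ((y j)(?i := t)) = poly (R j) t" if "j < r" "u ((y j)(?i := t)) \<noteq> 0" for j t
  proof -
    have "Q j dvd s" unfolding s_def using that by (intro dvd_prodI) auto
    then have "poly s t = poly (Q j) t * poly (s div Q j) t"
      by (metis dvd_mult_div_cancel poly_mult)
    then show ?thesis using PQ(2)[OF that] by (simp add: R_def)
  qed
  define G where "G x = (\<Sum>j<r. poly (R j) (x ?i) * L j x)" for x
  have L': "poly_fun (Suc n) (L j)" if "j < r" for j
    by (rule poly_fun_subst[OF node(2)[OF that]]) (auto intro: poly_fun_coord)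
  have G: "poly_fun (Suc n) G"
    unfolding G_def using L' by (intro poly_fun_sum poly_fun_mult poly_fun_poly poly_fun_coord) auto
  have G_eq: "poly s t * h (x(?i := t)) = G (x(?i := t))"
    if "t \<in> T - Z" "u (x(?i := t)) \<noteq> 0" for t x
  proof -
    have "L j (x(?i := t)) = L j x" if "j < r" for j
      by (rule poly_fun_cong[OF node(2)[OF that]]) auto
    moreover have "poly s t * h ((y j)(?i := t)) = poly (R j) t" if "j < r" for j
      using that \<open>t \<in> T - Z\<close> by (intro R) (auto simp: Z_def)
    ultimately show ?thesis
      unfolding h_interp[OF that] G_def sum_distrib_left
      by (intro sum.cong) (auto simp: mult.assoc[symmetric])
  qed
  \<comment> \<open>From \<open>t \<in> T - Z\<close> to every \<open>t\<close>: the line through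
    \<open>x\<close> still has infinitely many such parameters inside D(\<open>u\<close>).\<close>
  have "poly s (x ?i) * h x = G x" if ux: "u x \<noteq> 0" for x
  proof -
    have xS: "x \<in> S" using ux unfolding S_def by (auto intro: exI[of _ "x ?i"])
    have "u (x(?i := x ?i)) \<noteq> 0" using ux by simp
    then have "infinite (T - Z - {t. u (x(?i := t)) = 0})"
      by (intro Diff_infinite_finite[OF _ T'] finite_upd_zeros[OF Suc.prems(1)])
    then have "poly s (x ?i) * h (x(?i := x ?i)) = G (x(?i := x ?i))"
      by (rule line_rational_identity[OF h_line[OF xS] G]) (use G_eq ux in auto)
    then show ?thesis by simp
  qed
  moreover have "line_rational u h ?i x" if "u x \<noteq> 0" for x
    using that by (intro h_line) (auto simp: S_def intro: exI[of _ "x ?i"])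
  ultimately obtain N1 H where H: "poly_fun (Suc n) H" "\<And>x. u x \<noteq> 0 \<Longrightarrow> h x * u x ^ N1 = H x"
    using clear_denominator[OF inf _ Suc.prems(1) G s0, of ?i h] by auto
  then show ?case
    by (intro exI[of _ "N0 + N1"] exI[of _ H]) (auto simp: h_def power_add mult_ac)
qed

section \<open>Rational functions on the line\<close>

lemma poly_fun_one: "poly_fun 1 p \<Longrightarrow> \<exists>P. \<forall>x. p x = poly P (x 1)"
proof -
  assume p: "poly_fun 1 p"
  obtain P where P: "\<And>t. p (undefined(1 := t)) = poly P t"
    using poly_fun_upd_poly[OF p] by blast
  have "p x = p (undefined(1 := x 1))" for x by (rule poly_fun_cong[OF p]) auto
  then show ?thesis using P by metis
qed

lemma openin_zariski_basis:
  assumes "openin (zariski n) U" "x \<in> U"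
  obtains u where "poly_fun n u" "u x \<noteq> 0" "\<And>y. y \<in> affine_space n \<Longrightarrow> u y \<noteq> 0 \<Longrightarrow> y \<in> U"
  using assms unfolding openin_zariski zero_locus_def by blast

lemma restrict_affine_space: "restrict x {1..n} \<in> affine_space n"
  by (simp add: affine_space_def)

text \<open>Links polynomial identities, stated for all functions on \<open>nat\<close>, with points
  of \<open>affine_space n\<close>.\<close>

lemma poly_fun_restrict: "poly_fun n p \<Longrightarrow> p (restrict x {1..n}) = p x"
  by (rule poly_fun_cong) auto

text \<open>Regularity gives only local quotients. They hold on cofinite sets, any two of which meet
  in an infinite set, so all are one fraction; its reduced form has a denominator without zeros on
  \<open>dom g\<close>.\<close>

lemma rational_function_line:
  fixes g :: "'k::alg_closed_field \<rightharpoonup> 'k"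
  assumes inf: "infinite (UNIV :: 'k set)" and rat: "rational_function 1 (on_line g)"
  shows "\<exists>P Q. \<forall>t\<in>dom g. poly Q t \<noteq> 0 \<and> the (g t) = poly P t / poly Q t"
proof (cases "dom g = {}")
  case False
  define e :: "'k \<Rightarrow> nat \<Rightarrow> 'k" where "e t = restrict (\<lambda>_. t) {1..1}" for t
  have e: "e t \<in> affine_space 1" "e t 1 = t" for t
    by (auto simp: e_def affine_space_def)
  have on: "on_line g (e t) = g t" for t unfolding on_line_def using e by simp
  define rep where "rep P Q A \<longleftrightarrow> finite (- A) \<and>
      (\<forall>z\<in>A. poly Q z \<noteq> 0 \<and> the (g z) = poly P z / poly Q z)" for P Q A
  have loc: "\<exists>P Q A. t \<in> A \<and> rep P Q A" if t: "t \<in> dom g" for t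
  proof -
    have "e t \<in> dom (on_line g)" using t on by (auto simp: dom_def)
    then obtain V p q where V: "openin (zariski 1) V" "e t \<in> V" "poly_fun 1 p" "poly_fun 1 q"
      "\<And>y. y \<in> V \<Longrightarrow> q y \<noteq> 0 \<and> the (on_line g y) = p y / q y"
      using rat unfolding rational_function_def regular_on_def by meson
    obtain P where P: "\<And>x. p x = poly P (x 1)" using poly_fun_one[OF V(3)] by blast
    obtain Q where Q: "\<And>x. q x = poly Q (x 1)" using poly_fun_one[OF V(4)] by blast
    obtain u where u: "poly_fun 1 u" "u (e t) \<noteq> 0" "\<And>y. y \<in> affine_space 1 \<Longrightarrow> u y \<noteq> 0 \<Longrightarrow> y \<in> V"
      using openin_zariski_basis[OF V(1,2)] by blast
    obtain W where W: "\<And>x. u x = poly W (x 1)" using poly_fun_one[OF u(1)] by blast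
    have "W \<noteq> 0" using u(2) W by auto
    then have "finite (- {z. poly W z \<noteq> 0})" using poly_roots_finite[of W] by (simp add: Compl_eq)
    moreover have "poly Q z \<noteq> 0 \<and> the (g z) = poly P z / poly Q z" if "poly W z \<noteq> 0" for z
    proof -
      have "u (e z) \<noteq> 0" using that W[of "e z"] e(2)[of z] by simp
      then show ?thesis
        using V(5)[OF u(3)[OF e(1)], of z] P[of "e z"] Q[of "e z"] e(2)[of z] on[of z] by simp
    qed
    moreover have "t \<in> {z. poly W z \<noteq> 0}" using u(2) W e by simp
    ultimately show ?thesis unfolding rep_def
      by (intro exI[of _ P] exI[of _ Q] exI[of _ "{z. poly W z \<noteq> 0}"]) simp
  qed
  obtain t0 where t0: "t0 \<in> dom g" using False by blast
  obtain P0 Q0 A0 where "t0 \<in> A0" "rep P0 Q0 A0" using loc[OF t0] by blast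
  then have A0: "t0 \<in> A0" "finite (- A0)"
      "\<And>z. z \<in> A0 \<Longrightarrow> poly Q0 z \<noteq> 0 \<and> the (g z) = poly P0 z / poly Q0 z"
    unfolding rep_def by auto
  \<comment> \<open>Pairs representing the fraction \<open>P0 / Q0\<close>; the denominator of least
    degree is chosen among them.\<close>
  define same where "same R \<longleftrightarrow> snd R \<noteq> 0 \<and> P0 * snd R = fst R * Q0" for R
  have "same (P0, Q0)" using A0 unfolding same_def by auto
  then obtain R where R: "same R" and "\<And>R'. same R' \<Longrightarrow> degree (snd R) \<le> degree (snd R')"
    using ex_has_least_nat[of same "(P0, Q0)" "\<lambda>R. degree (snd R)"] by blast
  then obtain P Q where PQ: "Q \<noteq> 0" "P0 * Q = P * Q0"
    and least: "\<And>P' Q'. Q' \<noteq> 0 \<Longrightarrow> P0 * Q' = P' * Q0 \<Longrightarrow> degree Q \<le> degree Q'"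
    unfolding same_def by (metis fst_conv snd_conv)
  \<comment> \<open>Minimality of the degree replaces coprimality: \<^class>\<open>field\<close> provides no gcd for polynomials.\<close>
  have reduced: "\<not> (poly P t = 0 \<and> poly Q t = 0)" for t
  proof
    assume "poly P t = 0 \<and> poly Q t = 0"
    then obtain P' Q' where P': "P = [:-t, 1:] * P'" and Q': "Q = [:-t, 1:] * Q'"
      unfolding poly_eq_0_iff_dvd by (auto simp: dvd_def)
    have "[:-t, 1:] * (P0 * Q') = [:-t, 1:] * (P' * Q0)"
      using PQ(2) unfolding P' Q' by (simp only: mult_ac)
    then have "P0 * Q' = P' * Q0" by (subst (asm) mult_left_cancel) auto
    moreover have "Q' \<noteq> 0" using PQ(1) Q' by auto
    moreover have "degree Q = Suc (degree Q')"
      unfolding Q' using \<open>Q' \<noteq> 0\<close> by (subst degree_mult_eq) auto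
    ultimately show False using least by fastforce
  qed
  have "poly Q t \<noteq> 0 \<and> the (g t) = poly P t / poly Q t" if t: "t \<in> dom g" for t
  proof -
    obtain P1 Q1 A1 where "t \<in> A1" "rep P1 Q1 A1" using loc[OF t] by blast
    then have A1: "t \<in> A1" "finite (- A1)"
      "\<And>z. z \<in> A1 \<Longrightarrow> poly Q1 z \<noteq> 0 \<and> the (g z) = poly P1 z / poly Q1 z"
      unfolding rep_def by auto
    have "infinite (A0 \<inter> A1)"
      using A0(2) A1(2) inf by (metis Compl_Int finite_Un finite_compl)
    then have "P0 * Q1 = P1 * Q0"
    proof (rule poly_eq_on_infinite)
      fix z assume z: "z \<in> A0 \<inter> A1"
      show "poly (P0 * Q1) z = poly (P1 * Q0) z"
        using A0(3)[of z] A1(3)[of z] z by (simp add: field_simps)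
    qed
    then have "Q0 * (P1 * Q) = Q0 * (P * Q1)"
      using PQ(2) by (metis mult.assoc mult.commute)
    moreover have "Q0 \<noteq> 0" using A0 by auto
    ultimately have "P1 * Q = P * Q1" by simp
    then have cross: "poly P1 t * poly Q t = poly P t * poly Q1 t" by (metis poly_mult)
    \<comment> \<open>If \<open>Q\<close> vanished at \<open>t\<close>, then \<open>cross\<close>
      and \<open>poly Q1 t \<noteq> 0\<close> would make \<open>P\<close> vanish there as
      well.\<close>
    have "poly Q t \<noteq> 0" using reduced[of t] cross A1(1,3) by auto
    then show ?thesis using cross A1(1,3) by (auto simp: field_simps)
  qed
  then show ?thesis by blast
qed auto

section \<open>From lines to affine space\<close>

theorem theorem1p0p5:
  fixes n :: nat and f :: "(nat \<Rightarrow> 'k::alg_closed_field) \<rightharpoonup> 'k"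
  assumes "(UNIV :: real set) \<lesssim> (UNIV :: 'k set)"
    and "openin (zariski n) (dom f)"
    and "dom f \<noteq> {}"
    and "\<forall>a\<in>dom f. \<forall>i\<in>{1..n}. rational_function 1 (on_line (slice f a i))"
  shows "rational_function n f"
proof -
  have unc: "uncountable (UNIV :: 'k set)"
    using assms(1) uncountable_UNIV_real countable_lepoll by blast
  then have inf: "infinite (UNIV :: 'k set)" using countable_finite by blast
  have sub: "dom f \<subseteq> affine_space n" using openin_subset[OF assms(2)] topspace_zariski by blast
  \<comment> \<open>Density holds because any two nonempty open sets meet: each contains a nonempty
    basic open set, and the two polynomials have a common nonvanishing point.\<close>
  have "zariski n closure_of dom f = affine_space n"
  proof -
    have "dom f \<inter> V \<noteq> {}" if V: "openin (zariski n) V" "b \<in> V" for V b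
    proof -
      obtain a where a: "a \<in> dom f" using assms(3) by blast
      obtain u where u: "poly_fun n u" "u a \<noteq> 0" "\<And>y. y \<in> affine_space n \<Longrightarrow> u y \<noteq> 0 \<Longrightarrow> y \<in> dom f"
        using openin_zariski_basis[OF assms(2) a] by blast
      obtain v where v: "poly_fun n v" "v b \<noteq> 0" "\<And>y. y \<in> affine_space n \<Longrightarrow> v y \<noteq> 0 \<Longrightarrow> y \<in> V"
        using openin_zariski_basis[OF V] by blast
      obtain x where "u x \<noteq> 0" "v x \<noteq> 0"
        using poly_fun_nonzero_common[OF inf u(1) v(1) u(2) v(2)] by blast
      then have "restrict x {1..n} \<in> dom f \<inter> V"
        using u v restrict_affine_space poly_fun_restrict by (metis IntI)
      then show ?thesis by blast
    qed
    then show ?thesis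
      unfolding closure_of_def topspace_zariski by blast
  qed
  moreover have "regular_on n (dom f) (\<lambda>x. the (f x))"
    unfolding regular_on_def
  proof (intro conjI ballI assms(2))
    fix a assume a: "a \<in> dom f"
    obtain u where u: "poly_fun n u" "u a \<noteq> 0" "\<And>y. y \<in> affine_space n \<Longrightarrow> u y \<noteq> 0 \<Longrightarrow> y \<in> dom f"
      using openin_zariski_basis[OF assms(2) a] by blast
    \<comment> \<open>A total version of \<open>f\<close> on all functions on \<open>nat\<close>; it
      is used only where \<open>u\<close> is nonzero, and there the restricted point lies in
      \<open>dom f\<close>.\<close>
    define F where "F x = the (f (restrict x {1..n}))" for x
    have "\<exists>N G. poly_fun n G \<and> (\<forall>x. u x \<noteq> 0 \<longrightarrow> F x * u x ^ N = G x)"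
    proof (rule separately_rational_localization[OF unc u(1)])
      show "F x = F y" if "\<And>i. i \<in> {1..n} \<Longrightarrow> x i = y i" for x y
      proof -
        have "restrict x {1..n} = restrict y {1..n}" using that by (intro restrict_ext) auto
        then show ?thesis by (simp add: F_def)
      qed
      show "line_rational u F i x" if i: "i \<in> {1..n}" and ux: "u x \<noteq> 0" for x i
      proof -
        let ?a = "restrict x {1..n}"
        have "?a \<in> dom f" using u(3) restrict_affine_space poly_fun_restrict[OF u(1)] ux by metis
        then have "rational_function 1 (on_line (slice f ?a i))" using assms(4) i by blast
        then obtain P Q where PQ: "\<And>t. t \<in> dom (slice f ?a i) \<Longrightarrow>
            poly Q t \<noteq> 0 \<and> the (slice f ?a i t) = poly P t / poly Q t"
          using rational_function_line[OF inf] by blast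
        have upd: "?a(i := t) = restrict (x(i := t)) {1..n}" for t
          using i by (auto simp: fun_eq_iff)
        have "t \<in> dom (slice f ?a i)" if "u (x(i := t)) \<noteq> 0" for t
        proof -
          have "?a(i := t) \<in> dom f"
            unfolding upd using u(3) restrict_affine_space poly_fun_restrict[OF u(1)] that by metis
          then show ?thesis unfolding slice_def dom_def by simp
        qed
        then show ?thesis using PQ unfolding line_rational_def F_def upd[symmetric] slice_def by blast
      qed
    qed
    then obtain N G where G: "poly_fun n G" "\<And>x. u x \<noteq> 0 \<Longrightarrow> F x * u x ^ N = G x" by blast
    \<comment> \<open>The basic open set D(\<open>u\<close>) around \<open>a\<close>, on which
      \<open>f\<close> is the single quotient \<open>G / u ^ N\<close>.\<close>
    let ?V = "affine_space n - zero_locus n {u}"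
    have mem: "y \<in> ?V \<longleftrightarrow> y \<in> affine_space n \<and> u y \<noteq> 0" for y by (auto simp: zero_locus_def)
    have "openin (zariski n) ?V" unfolding openin_zariski using u(1) by blast
    moreover have "a \<in> ?V" using mem a sub u(2) by blast
    moreover have "?V \<subseteq> dom f" using mem u(3) by blast
    moreover have "u y ^ N \<noteq> 0 \<and> the (f y) = G y / u y ^ N" if "y \<in> ?V" for y
    proof -
      have "restrict y {1..n} = y" using that mem unfolding affine_space_def by (metis PiE_restrict)
      then have "F y = the (f y)" by (simp add: F_def)
      then show ?thesis using G(2)[of y] that mem by (auto simp: field_simps)
    qed
    ultimately show "\<exists>V p q. openin (zariski n) V \<and> a \<in> V \<and> V \<subseteq> dom f \<and> poly_fun n p \<and> poly_fun n q \<and>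
        (\<forall>y\<in>V. q y \<noteq> 0 \<and> the (f y) = p y / q y)"
      using G(1) poly_fun_power[OF u(1)] by blast
  qed
  ultimately show ?thesis
    unfolding rational_function_def topspace_zariski using assms(2) by blast
qed

end
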